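(* Consider a feasible separable subset-sum set $$\{(x^1,\dots,x^k)\in\{0,1\}^{n_1+\dots+n_k} : a^i x^i=b_i\ \ \forall i\in\{1,\dots,k\}\}$$ with nonnegative $(a^i,b_i)$, and let $\delta\in(0,1)$. Then with probability at least $1-\delta$, the algorithm WFP with $\ell=2$ returns a feasible solution within $$T=\lceil\ln(k/\delta)\rceil\sum_{i=1}^k n_i\,2^{2n_i\log n_i}\ \le\ \bar n\,k\,2^{2\bar n\log\bar n}\cdot\lceil\ln(k/\delta)\rceil$$ iterations, where $\bar n=\max_i n_i$.
   Context: $\log$ is base 2; $a^i\in\mathbb{R}^{n_i}_+$, $b_i\in\mathbb{R}_+$, $n_i\ge1$. Let $n=\sum_i n_i$ and let $P=\{(x^1,\dots,x^k)\in[0,1]^n: a^ix^i=b_i\ \forall i\}$ be the LP relaxation; feasible means $P\cap\{0,1\}^n\ne\emptyset$. $\mathrm{round}(v)$, for $v\in[0,1]^n$, rounds each component to the closest integer, with $\tfrac12$ rounded to $1$. For $\tilde x\in\{0,1\}^n$, $\ell_1\text{-proj}(P,\tilde x)$ denotes a point $x\in P$ minimizing $\|\tilde x-x\|_1$ (a fixed choice for each $\tilde x$); it is assumed that if $\tilde x\notin P$ then $\ell_1\text{-proj}(P,\tilde x)$ is a vertex of $P$. Projected certificate (pure-binary case): write the constraints as $Ax\le\beta$, each equality being two inequalities. For $\bar x\in\{0,1\}^n\setminus P$, a projected certificate is an inequality $\lambda Ax\le\lambda\beta$ with $\lambda\ge0$ that $\bar x$ violates; it is minimal if $\mathrm{supp}(\lambda)$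 is inclusion-wise minimal among projected certificates for $\bar x$. RandWalkSAT$_\ell(\bar x)$: take a minimal projected certificate $\alpha x\le\gamma$ for $\bar x$ (where $\alpha=\lambda A$, $\gamma=\lambda\beta$; chosen by any rule), sample $\ell$ indices from $\mathrm{supp}(\alpha)$ uniformly and independently (fresh randomness), let $\mathbf I$ be the set of indices obtained, and flip $\bar x_i\leftarrow1-\bar x_i$ for all $i\in\mathbf I$. Algorithm WFP with integer parameter $\ell\ge1$: let $\bar x^0$ be an optimal solution of the LP relaxation (for the given linear objective) and $\tilde x^0=\mathrm{round}(\bar x^0)$. For $t=1,2,\dots$ (iteration $t$): set $\bar x^t=\ell_1\text{-proj}(P,\tilde x^{t-1})$ and $\tilde x^t=\mathrm{round}(\bar x^t)$; if $\tilde x^t\in P$, return $\tilde x^t$; if $\tilde x^t=\tilde x^{t-1}$, replace $\tilde x^t$ by RandWalkSAT$_\ell(\tilde x^t)$. *)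

theory Defs
  imports "HOL-Analysis.Analysis" "HOL-Probability.Probability"
begin

text \<open>
  The coordinates are the elements of the finite type \<open>'v\<close>, and \<open>blk v :: 'k\<close> is the block to which
  coordinate \<open>v\<close> belongs. So \<open>k = CARD('k)\<close>, the subvector \<open>x\<^sup>i\<close> of \<open>x\<close> consists of the \<open>x $ v\<close>
  with \<open>blk v = i\<close>, and the vectors \<open>a\<^sup>1, \<dots>, a\<^sup>k\<close> are concatenated into one \<open>a :: real ^ 'v\<close>.
\<close>

definition block_size :: "('v::finite \<Rightarrow> 'k::finite) \<Rightarrow> 'k \<Rightarrow> nat" where
  "block_size blk i = card {v. blk v = i}"

definition binary :: "(real ^ 'v::finite) set" where
  "binary = {x. \<forall>v. x $ v \<in> {0, 1}}"

definition lp_relax :: "('v::finite \<Rightarrow> 'k::finite) \<Rightarrow> real ^ 'v \<Rightarrow> real ^ 'k \<Rightarrow> (real ^ 'v) set" where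
  "lp_relax blk a b =
     {x. (\<forall>v. 0 \<le> x $ v \<and> x $ v \<le> 1) \<and> (\<forall>i. (\<Sum>v | blk v = i. a $ v * x $ v) = b $ i)}"

text \<open>
  The equalities as a system \<open>A x \<le> \<beta>\<close>: row \<open>Inl i\<close> is \<open>a\<^sup>i x\<^sup>i \<le> b\<^sub>i\<close> and row \<open>Inr i\<close> is
  \<open>- a\<^sup>i x\<^sup>i \<le> - b\<^sub>i\<close>. The bounds \<open>0 \<le> x \<le> 1\<close> are not rows; no 0/1 point violates them.
\<close>

definition ineq_matrix :: "('v::finite \<Rightarrow> 'k::finite) \<Rightarrow> real ^ 'v \<Rightarrow> real ^ 'v ^ ('k + 'k)" where
  "ineq_matrix blk a = (\<chi> r v. case r of
       Inl i \<Rightarrow> (if blk v = i then a $ v else 0)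
     | Inr i \<Rightarrow> (if blk v = i then - a $ v else 0))"

definition ineq_rhs :: "real ^ 'k::finite \<Rightarrow> real ^ ('k + 'k)" where
  "ineq_rhs b = (\<chi> r. case r of Inl i \<Rightarrow> b $ i | Inr i \<Rightarrow> - b $ i)"

lemma lp_relax_eq_ineq:
  "lp_relax blk a b =
     {x. (\<forall>v. 0 \<le> x $ v \<and> x $ v \<le> 1) \<and>
         (\<forall>r. (ineq_matrix blk a *v x) $ r \<le> ineq_rhs b $ r)}"
proof -
  have l: "(ineq_matrix blk a *v x) $ Inl i = (\<Sum>v | blk v = i. a $ v * x $ v)" for x i
    by (simp add: ineq_matrix_def matrix_vector_mult_def if_distrib[of "\<lambda>t. t * _"]
        sum.If_cases cong: if_cong)
  have r: "(ineq_matrix blk a *v x) $ Inr i = - (\<Sum>v | blk v = i. a $ v * x $ v)" for x i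
    by (simp add: ineq_matrix_def matrix_vector_mult_def if_distrib[of "\<lambda>t. t * _"]
        sum.If_cases sum_negf cong: if_cong)
  have "(\<forall>r. (ineq_matrix blk a *v x) $ r \<le> ineq_rhs b $ r) \<longleftrightarrow>
      (\<forall>i. (\<Sum>v | blk v = i. a $ v * x $ v) = b $ i)" for x
    by (auto simp: split_sum_all l r ineq_rhs_def intro: antisym)
  then show ?thesis
    by (simp add: lp_relax_def)
qed

definition supp :: "real ^ 'i::finite \<Rightarrow> 'i set" where
  "supp z = {i. z $ i \<noteq> 0}"

definition l1_norm :: "real ^ 'v::finite \<Rightarrow> real" where
  "l1_norm x = (\<Sum>v\<in>UNIV. \<bar>x $ v\<bar>)"

definition round01 :: "real ^ 'v::finite \<Rightarrow> real ^ 'v" where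
  "round01 x = (\<chi> v. if x $ v \<ge> 1 / 2 then 1 else 0)"

definition is_l1_proj :: "((real ^ 'v::finite) set) \<Rightarrow> (real ^ 'v \<Rightarrow> real ^ 'v) \<Rightarrow> bool" where
  "is_l1_proj P proj \<longleftrightarrow>
     (\<forall>y\<in>binary. is_arg_min (\<lambda>x. l1_norm (y - x)) (\<lambda>x. x \<in> P) (proj y) \<and>
                 (y \<notin> P \<longrightarrow> proj y extreme_point_of P))"

definition projected_certificate ::
    "real ^ 'v::finite ^ 'r::finite \<Rightarrow> real ^ 'r \<Rightarrow> real ^ 'v \<Rightarrow> real ^ 'r \<Rightarrow> bool" where
  "projected_certificate A \<beta> x lam \<longleftrightarrow> (\<forall>r. 0 \<le> lam $ r) \<and> \<not> (lam v* A) \<bullet> x \<le> lam \<bullet> \<beta>"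

definition minimal_certificate ::
    "real ^ 'v::finite ^ 'r::finite \<Rightarrow> real ^ 'r \<Rightarrow> real ^ 'v \<Rightarrow> real ^ 'r \<Rightarrow> bool" where
  "minimal_certificate A \<beta> x lam \<longleftrightarrow>
     projected_certificate A \<beta> x lam \<and>
     \<not> (\<exists>mu. projected_certificate A \<beta> x mu \<and> supp mu \<subset> supp lam)"

definition flip :: "'v::finite set \<Rightarrow> real ^ 'v \<Rightarrow> real ^ 'v" where
  "flip I x = (\<chi> v. if v \<in> I then 1 - x $ v else x $ v)"

text \<open>
  A run is either still going, with the list of the 0/1 points visited so far (latest first, each
  after its RandWalkSAT modification, if any), or has returned a point. The minimal certificates may
  be chosen by any rule; here the rule may use the whole history and its own randomness.
\<close>

datatype 'x run = Running "'x list" | Returned 'x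

definition is_certificate_rule ::
    "real ^ 'v::finite ^ 'r::finite \<Rightarrow> real ^ 'r \<Rightarrow> (real ^ 'v) set \<Rightarrow>
     ((real ^ 'v) list \<Rightarrow> (real ^ 'r) pmf) \<Rightarrow> bool" where
  "is_certificate_rule A \<beta> P cert \<longleftrightarrow>
     (\<forall>x h. x \<in> binary - P \<longrightarrow> (\<forall>lam \<in> set_pmf (cert (x # h)). minimal_certificate A \<beta> x lam))"

definition rand_walk_sat ::
    "real ^ 'v::finite ^ 'r::finite \<Rightarrow> ((real ^ 'v) list \<Rightarrow> (real ^ 'r) pmf) \<Rightarrow> nat \<Rightarrow>
     (real ^ 'v) list \<Rightarrow> (real ^ 'v) pmf" where
  "rand_walk_sat A cert l h = do {
     lam \<leftarrow> cert h;
     js \<leftarrow> replicate_pmf l (pmf_of_set (supp (lam v* A)));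
     return_pmf (flip (set js) (hd h))
   }"

primrec wfp_step ::
    "real ^ 'v::finite ^ 'r::finite \<Rightarrow> (real ^ 'v) set \<Rightarrow> (real ^ 'v \<Rightarrow> real ^ 'v) \<Rightarrow>
     ((real ^ 'v) list \<Rightarrow> (real ^ 'r) pmf) \<Rightarrow> nat \<Rightarrow> (real ^ 'v) run \<Rightarrow> (real ^ 'v) run pmf" where
  "wfp_step A P proj cert l (Returned x) = return_pmf (Returned x)"
| "wfp_step A P proj cert l (Running h) =
     (let x = round01 (proj (hd h)) in
      if x \<in> P then return_pmf (Returned x)
      else if x = hd h then map_pmf (\<lambda>y. Running (y # h)) (rand_walk_sat A cert l h)
      else return_pmf (Running (x # h)))"

text \<open>The state after \<open>t\<close> iterations, started from the LP optimum \<open>x0\<close>.\<close>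

primrec wfp ::
    "real ^ 'v::finite ^ 'r::finite \<Rightarrow> (real ^ 'v) set \<Rightarrow> (real ^ 'v \<Rightarrow> real ^ 'v) \<Rightarrow>
     ((real ^ 'v) list \<Rightarrow> (real ^ 'r) pmf) \<Rightarrow> nat \<Rightarrow> real ^ 'v \<Rightarrow> nat \<Rightarrow> (real ^ 'v) run pmf" where
  "wfp A P proj cert l x0 0 = return_pmf (Running [round01 x0])"
| "wfp A P proj cert l x0 (Suc t) = wfp A P proj cert l x0 t \<bind> wfp_step A P proj cert l"

end

theory Submission
  imports Defs
begin

text \<open>
  Write \<open>pump\<close> for projection followed by rounding. A vertex of \<open>P\<close> has at most one fractional
  coordinate per block, so after one application of \<open>pump\<close> each block is feasible or can be repaired by
  moving one coordinate by at most \<open>1/2\<close>; such blocks are fixed by \<open>pump\<close>. Hence at most two iterations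
  pass per random step, and a random step affects a single block, since a minimal certificate is
  supported on a single row.

  Fix a feasible 0/1 point. For an infeasible block that \<open>pump\<close> fixes, some flip of one or two of its
  coordinates, followed by \<open>pump\<close>, brings it nearer to that point in Hamming distance, and from distance
  at most 2 the point is reached by a single flip. So each random step on a block of size \<open>n\<close> makes
  progress with probability at least \<open>1/n\<^sup>2\<close>, and \<open>n - 1\<close> consecutive successes suffice. These
  \<open>n - 1\<close> instead of \<open>n\<close> successes gain a factor \<open>n\<^sup>2\<close>, which pays for the second iteration per
  random step.

  The certificate rule may interleave the blocks adversarially. Therefore each block gets its own
  budget of random steps, and the failure probability is bounded by the sum over the blocks, by
  induction on the number of remaining iterations.
\<close>

section \<open>Elementary facts on 0/1 points\<close>

lemma binaryD: "y \<in> binary \<Longrightarrow> y $ v = 0 \<or> y $ v = 1"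
  by (auto simp: binary_def)

lemma round01_binary: "round01 x \<in> binary"
  by (auto simp: binary_def round01_def)

lemma round01_nth: "round01 x $ v = (if x $ v \<ge> 1 / 2 then 1 else 0)"
  by (simp add: round01_def)

lemma flip_nth: "flip J y $ v = (if v \<in> J then 1 - y $ v else y $ v)"
  by (simp add: flip_def)

lemma flip_binary: "y \<in> binary \<Longrightarrow> flip J y \<in> binary"
  by (auto simp: binary_def flip_def)

section \<open>Slacks and the projection, block by block\<close>

locale subset_sum =
  fixes blk :: "'v::finite \<Rightarrow> 'k::finite"
    and a :: "real ^ 'v" and b :: "real ^ 'k"
    and proj :: "real ^ 'v \<Rightarrow> real ^ 'v"
    and xs :: "real ^ 'v"
  assumes a_nonneg: "\<And>v. a $ v \<ge> 0"
    and xs_feasible: "xs \<in> lp_relax blk a b" "xs \<in> binary"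
    and proj: "is_l1_proj (lp_relax blk a b) proj"
begin

abbreviation P where "P \<equiv> lp_relax blk a b"

definition slack :: "'k \<Rightarrow> real ^ 'v \<Rightarrow> real" where
  "slack i y = (\<Sum>v | blk v = i. a $ v * y $ v) - b $ i"

text \<open>
  The strict inequality in the last case is due to \<open>1/2\<close> being rounded up.
\<close>

definition settled :: "'k \<Rightarrow> real ^ 'v \<Rightarrow> bool" where
  "settled i y \<longleftrightarrow> slack i y = 0
     \<or> (slack i y > 0 \<and> (\<exists>u. blk u = i \<and> y $ u = 1 \<and> 2 * slack i y \<le> a $ u))
     \<or> (slack i y < 0 \<and> (\<exists>u. blk u = i \<and> y $ u = 0 \<and> - 2 * slack i y < a $ u))"

definition pump :: "real ^ 'v \<Rightarrow> real ^ 'v" where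
  "pump y = round01 (proj y)"

text \<open>Coordinates of zero weight are left out: they do not affect the slack, and the support
  of a minimal certificate does not contain them.\<close>

definition conflicts :: "'k \<Rightarrow> real ^ 'v \<Rightarrow> 'v set" where
  "conflicts i y = {v. blk v = i \<and> a $ v > 0 \<and> y $ v \<noteq> xs $ v}"

lemma mem_P_iff: "x \<in> P \<longleftrightarrow> (\<forall>v. 0 \<le> x $ v \<and> x $ v \<le> 1) \<and> (\<forall>i. slack i x = 0)"
  by (simp add: lp_relax_def slack_def)

lemma binary_mem_P_iff: "x \<in> binary \<Longrightarrow> x \<in> P \<longleftrightarrow> (\<forall>i. slack i x = 0)"
  unfolding mem_P_iff using binaryD[of x] by (metis order_refl zero_le_one)

lemma slack_diff: "slack i y = slack i x + (\<Sum>v | blk v = i. a $ v * (y $ v - x $ v))"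
  by (simp add: slack_def right_diff_distrib sum_subtractf)

lemma slack_cong: "(\<And>v. blk v = i \<Longrightarrow> x $ v = y $ v) \<Longrightarrow> slack i x = slack i y"
  by (simp add: slack_def)

lemma settled_cong: "(\<And>v. blk v = i \<Longrightarrow> x $ v = y $ v) \<Longrightarrow> settled i x \<longleftrightarrow> settled i y"
  using slack_cong[of i x y] unfolding settled_def by auto

lemma conflicts_cong: "(\<And>v. blk v = i \<Longrightarrow> x $ v = y $ v) \<Longrightarrow> conflicts i x = conflicts i y"
  by (auto simp: conflicts_def)

lemma slack_update:
  assumes "blk u = i"
  shows "slack i (\<chi> v. if v = u then t else y $ v) = slack i y + a $ u * (t - y $ u)"
proof -
  have "(\<Sum>v | blk v = i. a $ v * ((if v = u then t else y $ v) - y $ v))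
      = (\<Sum>v | blk v = i. if v = u then a $ u * (t - y $ u) else 0)"
    by (intro sum.cong) auto
  also have "\<dots> = a $ u * (t - y $ u)"
    using assms by simp
  finally show ?thesis
    by (subst slack_diff[of _ _ y]) simp
qed

lemma proj_mem: "y \<in> binary \<Longrightarrow> proj y \<in> P"
  using proj by (auto simp: is_l1_proj_def is_arg_min_def)

lemma pump_binary: "pump y \<in> binary"
  by (simp add: pump_def round01_binary)

text \<open>Blocks share no constraint, so exchanging block \<open>i\<close> of
  \<open>proj y\<close> for \<open>w\<close> yields a competitor in \<open>P\<close>; in the
  comparison of distances the other blocks cancel.\<close>

lemma proj_block_le:
  assumes y: "y \<in> binary" and w: "\<And>v. blk v = i \<Longrightarrow> 0 \<le> w $ v \<and> w $ v \<le> 1" "slack i w = 0"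
  shows "(\<Sum>v | blk v = i. \<bar>y $ v - proj y $ v\<bar>) \<le> (\<Sum>v | blk v = i. \<bar>y $ v - w $ v\<bar>)"
proof -
  define z where "z = (\<chi> v. if blk v = i then w $ v else proj y $ v)"
  have x: "proj y \<in> P"
    using y by (rule proj_mem)
  have "slack j z = 0" for j
  proof (cases "j = i")
    case True
    then show ?thesis using w(2) slack_cong[of i z w] by (simp add: z_def)
  next
    case False
    then have "slack j z = slack j (proj y)"
      by (intro slack_cong) (auto simp: z_def)
    then show ?thesis using x by (simp add: mem_P_iff)
  qed
  then have "z \<in> P"
    using w(1) x by (auto simp: mem_P_iff z_def)
  then have le: "l1_norm (y - proj y) \<le> l1_norm (y - z)"
    using proj y unfolding is_l1_proj_def is_arg_min_def by fastforce
  have split: "l1_norm t = (\<Sum>v | blk v = i. \<bar>t $ v\<bar>) + (\<Sum>v | blk v \<noteq> i. \<bar>t $ v\<bar>)" for t :: "real ^ 'v"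
    unfolding l1_norm_def by (subst sum.union_disjoint[symmetric]) (auto intro: sum.cong)
  show ?thesis
    using le unfolding split by (simp add: z_def)
qed

text \<open>Moving the single coordinate \<open>u\<close> by \<open>slack i y / a $ u\<close>
  repairs the block; \<open>dir\<close> says that \<open>u\<close> has room in that
  direction.\<close>

lemma proj_dist_le:
  assumes y: "y \<in> binary" and u: "blk u = i" "\<bar>slack i y\<bar> \<le> a $ u" "a $ u > 0"
    and dir: "0 \<le> slack i y \<and> y $ u = 1 \<or> slack i y \<le> 0 \<and> y $ u = 0"
  shows "(\<Sum>v | blk v = i. \<bar>y $ v - proj y $ v\<bar>) \<le> \<bar>slack i y\<bar> / a $ u"
proof -
  define t where "t = y $ u - slack i y / a $ u"
  define w where "w = (\<chi> v. if v = u then t else y $ v)"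
  have "slack i w = 0"
    using u slack_update[of u i t y] by (simp add: w_def t_def)
  moreover have "0 \<le> t \<and> t \<le> 1"
    using dir u by (auto simp: t_def field_simps)
  then have "0 \<le> w $ v \<and> w $ v \<le> 1" for v
    using binaryD[OF y, of v] by (auto simp: w_def)
  ultimately have "(\<Sum>v | blk v = i. \<bar>y $ v - proj y $ v\<bar>) \<le> (\<Sum>v | blk v = i. \<bar>y $ v - w $ v\<bar>)"
    by (intro proj_block_le y) auto
  also have "\<dots> = (\<Sum>v | blk v = i. if v = u then \<bar>y $ u - t\<bar> else 0)"
    by (intro sum.cong) (auto simp: w_def)
  also have "\<dots> = \<bar>slack i y\<bar> / a $ u"
    using u by (simp add: t_def abs_divide)
  finally show ?thesis .
qed

text \<open>A 0/1 coordinate changes only if the projection moves it by at least 1/2, so two changes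
  would cost 1, but repairing through \<open>u\<close> costs less.\<close>

lemma pump_changes_at_most_one:
  assumes y: "y \<in> binary" and u: "blk u = i" "\<bar>slack i y\<bar> < a $ u"
    and dir: "0 \<le> slack i y \<and> y $ u = 1 \<or> slack i y \<le> 0 \<and> y $ u = 0"
  shows "card {v. blk v = i \<and> pump y $ v \<noteq> y $ v} \<le> 1"
proof (rule ccontr)
  let ?C = "{v. blk v = i \<and> pump y $ v \<noteq> y $ v}"
  assume "\<not> card ?C \<le> 1"
  then have "2 \<le> card ?C"
    by simp
  have "1 / 2 \<le> \<bar>y $ v - proj y $ v\<bar>" if "v \<in> ?C" for v
    using that binaryD[OF y, of v] by (auto simp: pump_def round01_nth split: if_splits)
  then have "real (card ?C) * (1 / 2) \<le> (\<Sum>v\<in>?C. \<bar>y $ v - proj y $ v\<bar>)"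
    by (intro sum_bounded_below) auto
  also have "\<dots> \<le> (\<Sum>v | blk v = i. \<bar>y $ v - proj y $ v\<bar>)"
    by (intro sum_mono2) auto
  also have "\<dots> \<le> \<bar>slack i y\<bar> / a $ u"
    using assms by (intro proj_dist_le) auto
  also have "\<dots> < 1"
    using u by (auto simp: divide_less_eq)
  finally show False
    using \<open>2 \<le> card ?C\<close> by linarith
qed

text \<open>The block moves by at most 1/2 in total, which rounding undoes unless a coordinate goes
  from 0 to exactly 1/2.\<close>

lemma pump_settled:
  assumes y: "y \<in> binary" and st: "settled i y" and v: "blk v = i"
  shows "pump y $ v = y $ v"
proof -
  let ?d = "\<lambda>v. \<bar>y $ v - proj y $ v\<bar>"
  have le: "?d v \<le> (\<Sum>v | blk v = i. ?d v)"
    using v by (intro member_le_sum) auto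
  have strict: ?thesis if "?d v < 1 / 2"
    using that binaryD[OF y, of v] by (auto simp: pump_def round01_nth split: if_splits)
  consider "slack i y = 0"
    | u where "slack i y > 0" "blk u = i" "y $ u = 1" "2 * slack i y \<le> a $ u"
    | u where "slack i y < 0" "blk u = i" "y $ u = 0" "- 2 * slack i y < a $ u"
    using st unfolding settled_def by blast
  then show ?thesis
  proof cases
    case 1
    have "(\<Sum>v | blk v = i. ?d v) \<le> (\<Sum>v | blk v = i. \<bar>y $ v - y $ v\<bar>)"
      using binaryD[OF y] by (intro proj_block_le y 1) (metis order_refl zero_le_one)
    then show ?thesis
      using le by (intro strict) simp
  next
    case (2 u)
    have "(\<Sum>v | blk v = i. ?d v) \<le> \<bar>slack i y\<bar> / a $ u"
      using 2 by (intro proj_dist_le y) auto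
    also have "\<dots> \<le> 1 / 2"
      using 2 by (auto simp: divide_le_eq)
    finally have half: "(\<Sum>v | blk v = i. ?d v) \<le> 1 / 2" .
    show ?thesis
    proof (cases "y $ v = 0 \<and> proj y $ v = 1 / 2")
      \<comment> \<open>The tie: \<open>v\<close> uses up the whole distance 1/2, so nothing else in
        the block moves, and raising \<open>v\<close> cannot bring a positive slack down to
        0.\<close>
      case True
      have "(\<Sum>v | blk v = i. ?d v) = ?d v + (\<Sum>v\<in>{v. blk v = i} - {v}. ?d v)"
        using v by (intro sum.remove) auto
      then have "(\<Sum>v\<in>{v. blk v = i} - {v}. ?d v) \<le> 0"
        using half True by simp
      then have rest: "?d v' = 0" if "blk v' = i" "v' \<noteq> v" for v'
        using that sum_nonneg_eq_0_iff[of "{v. blk v = i} - {v}" ?d] sum_nonneg[of "{v. blk v = i} - {v}" ?d]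
        by fastforce
      have "y $ v' \<le> proj y $ v'" if "blk v' = i" for v'
        using True rest[OF that] by (cases "v' = v") auto
      then have "slack i y \<le> slack i (proj y)"
        unfolding slack_def using a_nonneg by (intro diff_right_mono sum_mono mult_left_mono) auto
      moreover have "slack i (proj y) = 0"
        using proj_mem[OF y] by (simp add: mem_P_iff)
      ultimately show ?thesis
        using 2 by simp
    next
      case False
      then show ?thesis
        using half le binaryD[OF y, of v] by (auto simp: pump_def round01_nth split: if_splits)
    qed
  next
    case (3 u)
    have "(\<Sum>v | blk v = i. ?d v) \<le> \<bar>slack i y\<bar> / a $ u"
      using 3 by (intro proj_dist_le y) auto
    also have "\<dots> < 1 / 2"
      using 3 by (subst pos_divide_less_eq) auto
    finally show ?thesis
      using le by (intro strict) simp
  qed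
qed

lemma pump_fixed: "y \<in> binary \<Longrightarrow> (\<And>i. settled i y) \<Longrightarrow> pump y = y"
  by (simp add: vec_eq_iff pump_settled)

lemma pump_feasible: "y \<in> binary \<Longrightarrow> y \<in> P \<Longrightarrow> pump y = y"
  by (intro pump_fixed) (auto simp: settled_def mem_P_iff)

section \<open>Rounding of vertices\<close>

text \<open>A block has only one equality, so two fractional coordinates could be shifted both ways
  along its kernel, making \<open>x\<close> the midpoint of two points of \<open>P\<close>.\<close>

lemma vertex_fractional_unique:
  assumes x: "x extreme_point_of P" and "blk u = i" "blk v = i"
    and u: "0 < x $ u" "x $ u < 1" and v: "0 < x $ v" "x $ v < 1"
  shows "u = v"
proof (rule ccontr)
  assume "u \<noteq> v"
  obtain p q where pq: "a $ u * p + a $ v * q = 0" "p \<noteq> 0 \<or> q \<noteq> 0"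
  proof (cases "a $ u = 0")
    case True
    then show ?thesis using that[of 1 0] by simp
  next
    case False
    then show ?thesis using that[of "- a $ v" "a $ u"] by (simp add: mult.commute)
  qed
  \<comment> \<open>Scaled so that neither shift exceeds the distance of \<open>x $ u\<close> or
    \<open>x $ v\<close> to the bounds 0 and 1.\<close>
  define \<epsilon> where "\<epsilon> = Min {x $ u, 1 - x $ u, x $ v, 1 - x $ v} / (\<bar>p\<bar> + \<bar>q\<bar>)"
  have pos: "0 < \<bar>p\<bar> + \<bar>q\<bar>"
    using pq by linarith
  then have \<epsilon>: "\<epsilon> > 0" "\<epsilon> * (\<bar>p\<bar> + \<bar>q\<bar>) = Min {x $ u, 1 - x $ u, x $ v, 1 - x $ v}"
    using u v by (auto simp: \<epsilon>_def)
  have "\<epsilon> * \<bar>p\<bar> \<le> \<epsilon> * (\<bar>p\<bar> + \<bar>q\<bar>)" "\<epsilon> * \<bar>q\<bar> \<le> \<epsilon> * (\<bar>p\<bar> + \<bar>q\<bar>)"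
    using \<epsilon>(1) by (auto intro!: mult_left_mono)
  then have "\<bar>\<epsilon> * p\<bar> \<le> Min {x $ u, 1 - x $ u, x $ v, 1 - x $ v}"
    "\<bar>\<epsilon> * q\<bar> \<le> Min {x $ u, 1 - x $ u, x $ v, 1 - x $ v}"
    using \<epsilon> by (simp_all add: abs_mult)
  then have bd: "\<bar>\<epsilon> * p\<bar> \<le> x $ u" "\<bar>\<epsilon> * p\<bar> \<le> 1 - x $ u" "\<bar>\<epsilon> * q\<bar> \<le> x $ v" "\<bar>\<epsilon> * q\<bar> \<le> 1 - x $ v"
    by simp_all
  define d :: "real ^ 'v" where "d = (\<chi> w. if w = u then \<epsilon> * p else if w = v then \<epsilon> * q else 0)"
  have xP: "x \<in> P" and ext: "\<And>y z. y \<in> P \<Longrightarrow> z \<in> P \<Longrightarrow> x \<notin> open_segment y z"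
    using x by (auto simp: extreme_point_of_def)
  have mem: "x + s *\<^sub>R d \<in> P" if s: "s = 1 \<or> s = - 1" for s
  proof -
    have "slack j (x + s *\<^sub>R d) = 0" for j
    proof (cases "j = i")
      case False
      then have "slack j (x + s *\<^sub>R d) = slack j x"
        using assms(2,3) by (intro slack_cong) (auto simp: d_def)
      then show ?thesis using xP by (simp add: mem_P_iff)
    next
      case True
      have "(\<Sum>w | blk w = i. a $ w * ((x + s *\<^sub>R d) $ w - x $ w))
          = (\<Sum>w | blk w = i. (if w = u then a $ u * (s * \<epsilon> * p) else 0) + (if w = v then a $ v * (s * \<epsilon> * q) else 0))"
        using \<open>u \<noteq> v\<close> by (intro sum.cong) (auto simp: d_def)
      also have "\<dots> = a $ u * (s * \<epsilon> * p) + a $ v * (s * \<epsilon> * q)"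
        using assms(2,3) by (simp add: sum.distrib)
      also have "\<dots> = s * \<epsilon> * (a $ u * p + a $ v * q)"
        by (simp add: algebra_simps)
      finally have "slack i (x + s *\<^sub>R d) = slack i x"
        using pq slack_diff[of i "x + s *\<^sub>R d" x] by simp
      then show ?thesis using xP True by (simp add: mem_P_iff)
    qed
    moreover have "0 \<le> (x + s *\<^sub>R d) $ w \<and> (x + s *\<^sub>R d) $ w \<le> 1" for w
      using xP s bd by (auto simp: mem_P_iff d_def abs_le_iff)
    ultimately show ?thesis
      by (simp add: mem_P_iff)
  qed
  have "d \<noteq> 0"
  proof
    assume "d = 0"
    then have "d $ u = 0" "d $ v = 0" by simp_all
    then show False using \<epsilon>(1) pq \<open>u \<noteq> v\<close> by (auto simp: d_def)
  qed
  then have "1 *\<^sub>R d \<noteq> (- 1) *\<^sub>R d"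
    unfolding real_vector.scale_cancel_right by simp
  then have "midpoint (x + 1 *\<^sub>R d) (x + (- 1) *\<^sub>R d) \<in> open_segment (x + 1 *\<^sub>R d) (x + (- 1) *\<^sub>R d)"
    unfolding midpoint_in_open_segment add_left_cancel .
  moreover have "midpoint (x + 1 *\<^sub>R d) (x + (- 1) *\<^sub>R d) = x"
    by (simp add: midpoint_def scaleR_2[symmetric])
  ultimately show False
    using ext[OF mem[of 1] mem[of "- 1"]] by metis
qed

text \<open>Outside \<open>P\<close> the projection is a vertex, so rounding alters at most one
  coordinate \<open>w\<close> of the block, by at most 1/2; undoing this is the repair that
  \<open>settled\<close> asks for.\<close>

lemma settled_pump:
  assumes y: "y \<in> binary"
  shows "settled i (pump y)"
proof (cases "y \<in> P")
  case True
  then show ?thesis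
    using pump_feasible[OF y True] by (auto simp: settled_def mem_P_iff)
next
  case False
  let ?x = "proj y"
  have x: "?x extreme_point_of P" "?x \<in> P"
    using proj y False proj_mem by (auto simp: is_l1_proj_def)
  have sx: "slack i ?x = 0" and xb: "\<And>v. 0 \<le> ?x $ v" "\<And>v. ?x $ v \<le> 1"
    using x(2) by (auto simp: mem_P_iff)
  have int: "pump y $ v = ?x $ v" if "?x $ v = 0 \<or> ?x $ v = 1" for v
    using that by (auto simp: pump_def round01_nth)
  show ?thesis
  proof (cases "\<exists>w. blk w = i \<and> 0 < ?x $ w \<and> ?x $ w < 1")
    case False
    then have "slack i (pump y) = slack i ?x"
      using xb by (intro slack_cong int) (metis (no_types, lifting) less_eq_real_def)
    then show ?thesis
      using sx by (simp add: settled_def)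
  next
    case True
    then obtain w where w: "blk w = i" "0 < ?x $ w" "?x $ w < 1"
      by blast
    have "slack i (pump y) = slack i (\<chi> v. if v = w then pump y $ w else ?x $ v)"
    proof (rule slack_cong)
      fix v assume v: "blk v = i"
      show "pump y $ v = (\<chi> v. if v = w then pump y $ w else ?x $ v) $ v"
      proof (cases "v = w")
        case False
        then have "\<not> (0 < ?x $ v \<and> ?x $ v < 1)"
          using vertex_fractional_unique[OF x(1) v w(1) _ _ w(2,3)] by blast
        then have "?x $ v = 0 \<or> ?x $ v = 1"
          using xb[of v] by linarith
        then show ?thesis
          using False int by simp
      qed simp
    qed
    also have "\<dots> = a $ w * (pump y $ w - ?x $ w)"
      using slack_update[OF w(1)] sx by simp
    finally have s: "slack i (pump y) = a $ w * (pump y $ w - ?x $ w)" .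
    show ?thesis
    proof (cases "a $ w = 0")
      case True
      then show ?thesis using s by (simp add: settled_def)
    next
      case False
      then have "a $ w > 0"
        using a_nonneg[of w] by simp
      show ?thesis
      proof (cases "?x $ w \<ge> 1 / 2")
        case True
        then have p: "pump y $ w = 1"
          by (simp add: pump_def round01_nth)
        have "a $ w * (2 * (1 - ?x $ w)) \<le> a $ w * 1"
          using True \<open>a $ w > 0\<close> by (intro mult_left_mono) auto
        moreover have "slack i (pump y) > 0"
          using \<open>a $ w > 0\<close> w unfolding s p by simp
        ultimately have "2 * slack i (pump y) \<le> a $ w" "slack i (pump y) > 0"
          unfolding s p by (simp_all add: algebra_simps)
        then show ?thesis
          using w(1) p unfolding settled_def by blast
      next
        \<comment> \<open>Rounding down happens only below 1/2, which gives the strict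
          inequality.\<close>
        case False
        then have p: "pump y $ w = 0"
          by (simp add: pump_def round01_nth)
        have "a $ w * (2 * ?x $ w) < a $ w * 1"
          using False \<open>a $ w > 0\<close> by (intro mult_strict_left_mono) auto
        moreover have "slack i (pump y) < 0"
          using \<open>a $ w > 0\<close> w unfolding s p by simp
        moreover have "- 2 * slack i (pump y) = a $ w * (2 * ?x $ w)"
          unfolding s p by simp
        ultimately have "- 2 * slack i (pump y) < a $ w" "slack i (pump y) < 0"
          by linarith+
        then show ?thesis
          using w(1) p unfolding settled_def by blast
      qed
    qed
  qed
qed

section \<open>Flips towards the feasible point \<open>xs\<close>\<close>

text \<open>At a conflict \<open>xs $ v = 1 - y $ v\<close>, so the difference to \<open>xs\<close>,
  whose slack is 0, is the sign \<open>2 * y $ v - 1\<close>.\<close>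

lemma slack_conflicts:
  assumes y: "y \<in> binary"
  shows "slack i y = (\<Sum>v\<in>conflicts i y. a $ v * (2 * y $ v - 1))"
proof -
  have "slack i y = (\<Sum>v | blk v = i. a $ v * (y $ v - xs $ v))"
    using slack_diff[of i y xs] xs_feasible by (simp add: mem_P_iff)
  also have "\<dots> = (\<Sum>v\<in>conflicts i y. a $ v * (y $ v - xs $ v))"
    using a_nonneg by (intro sum.mono_neutral_right) (auto simp: conflicts_def less_le)
  also have "\<dots> = (\<Sum>v\<in>conflicts i y. a $ v * (2 * y $ v - 1))"
  proof (intro sum.cong refl)
    fix v assume "v \<in> conflicts i y"
    then show "a $ v * (y $ v - xs $ v) = a $ v * (2 * y $ v - 1)"
      using binaryD[OF y, of v] binaryD[OF xs_feasible(2), of v] by (auto simp: conflicts_def)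
  qed
  finally show ?thesis .
qed

lemma slack_flip:
  assumes "J \<subseteq> {v. blk v = i}"
  shows "slack i (flip J y) = slack i y - (\<Sum>v\<in>J. a $ v * (2 * y $ v - 1))"
proof -
  have "(\<Sum>v | blk v = i. a $ v * (flip J y $ v - y $ v)) = (\<Sum>v\<in>J. a $ v * (flip J y $ v - y $ v))"
    using assms by (intro sum.mono_neutral_right) (auto simp: flip_nth)
  also have "\<dots> = (\<Sum>v\<in>J. - (a $ v * (2 * y $ v - 1)))"
    by (intro sum.cong) (auto simp: flip_nth algebra_simps)
  finally show ?thesis
    by (subst slack_diff[of _ _ y]) (simp add: sum_negf)
qed

lemma conflicts_flip:
  assumes "y \<in> binary" "J \<subseteq> conflicts i y"
  shows "conflicts i (flip J y) = conflicts i y - J"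
proof -
  have "1 - y $ v = xs $ v" if "v \<in> J" for v
    using that assms binaryD[of y v] binaryD[OF xs_feasible(2), of v] by (auto simp: conflicts_def)
  then show ?thesis
    using assms by (auto simp: conflicts_def flip_nth)
qed

text \<open>Unites the two signs of the slack: a product of 1 says that flipping \<open>u\<close>
  pushes the slack in the direction of 0.\<close>

lemma settled_blockmate:
  assumes "settled i y" "slack i y \<noteq> 0"
  obtains u where "blk u = i" "sgn (slack i y) * (2 * y $ u - 1) = 1" "2 * \<bar>slack i y\<bar> \<le> a $ u"
    "slack i y < 0 \<Longrightarrow> 2 * \<bar>slack i y\<bar> < a $ u"
  using assms unfolding settled_def by fastforce

text \<open>
  Let \<open>g\<close> be the absolute slack. If some conflicting coordinate \<open>u\<close> whose flip reduces the slack has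
  \<open>a\<^sub>u \<le> g\<close>, then flipping \<open>u\<close> keeps the block settled. Otherwise conflicts of both directions exist,
  and after flipping one of each the distance to \<open>P\<close> is below 1, so that \<open>pump\<close> undoes at most one of the
  two corrections.
\<close>

lemma descending_flip:
  assumes y: "y \<in> binary" and st: "settled i y" and nz: "slack i y \<noteq> 0"
  obtains u v where "u \<in> conflicts i y" "v \<in> conflicts i y"
    "card (conflicts i (pump (flip {u, v} y))) < card (conflicts i y)"
    "u \<noteq> v \<or> (\<exists>w. blk w = i \<and> w \<noteq> u)"
proof -
  define \<sigma> where "\<sigma> = sgn (slack i y)"
  define g where "g = \<bar>slack i y\<bar>"
  \<comment> \<open>\<open>e v\<close> is \<open>1\<close> if flipping \<open>v\<close> pushes the
    slack in the direction of 0 and \<open>- 1\<close> if it pushes away; the factor \<sigma> treats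
    both signs of the slack at once.\<close>
  define e where "e v = \<sigma> * (2 * y $ v - 1)" for v
  let ?D = "conflicts i y"
  have \<sigma>: "\<sigma> = 1 \<or> \<sigma> = - 1" "\<sigma> * slack i y = g" "g > 0" "slack i y = \<sigma> * g"
    using nz by (auto simp: \<sigma>_def g_def sgn_if)
  have e: "e v = 1 \<or> e v = - 1" for v
    using \<sigma>(1) binaryD[OF y, of v] by (auto simp: e_def)
  have g: "g = (\<Sum>v\<in>?D. a $ v * e v)"
    unfolding \<sigma>(2)[symmetric] slack_conflicts[OF y] e_def sum_distrib_left
    by (intro sum.cong) auto
  have flip: "slack i (flip J y) = \<sigma> * (g - (\<Sum>v\<in>J. a $ v * e v))" if "J \<subseteq> ?D" for J
  proof -
    have "(\<Sum>v\<in>J. a $ v * e v) = \<sigma> * (\<Sum>v\<in>J. a $ v * (2 * y $ v - 1))"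
      unfolding e_def sum_distrib_left by (intro sum.cong) auto
    moreover have "\<sigma> * \<sigma> = 1" using \<sigma>(1) by auto
    ultimately have "\<sigma> * (g - (\<Sum>v\<in>J. a $ v * e v)) = slack i y - (\<Sum>v\<in>J. a $ v * (2 * y $ v - 1))"
      using \<sigma>(4) by (simp add: right_diff_distrib flip: mult.assoc)
    then show ?thesis
      using that slack_flip[of J i y] by (auto simp: conflicts_def)
  qed
  obtain u0 where u0: "blk u0 = i" "e u0 = 1" "2 * g \<le> a $ u0" "\<sigma> = - 1 \<Longrightarrow> 2 * g < a $ u0"
    using settled_blockmate[OF st nz] unfolding e_def \<sigma>_def g_def
    by (metis linorder_neqE_linordered_idom nz sgn_neg sgn_pos zero_neq_neg_one one_neq_neg_one)
  \<comment> \<open>The positive \<open>g\<close> sums \<open>a $ v * e v\<close> over the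
    conflicts, so some summand is positive.\<close>
  obtain u where u: "u \<in> ?D" "e u = 1"
  proof (rule ccontr)
    assume "\<not> thesis"
    then have "\<forall>v\<in>?D. e v = - 1" using that e by blast
    then have "g \<le> 0" unfolding g using a_nonneg by (intro sum_nonpos) auto
    then show False using \<sigma> by simp
  qed
  show ?thesis
  proof (cases "\<exists>u\<in>?D. e u = 1 \<and> a $ u \<le> g")
    case True
    then obtain u where u: "u \<in> ?D" "e u = 1" "a $ u \<le> g"
      by blast
    \<comment> \<open>\<open>{u, u}\<close> expresses a single flip, which occurs when both samples
      coincide.\<close>
    let ?y = "flip {u, u} y"
    have ne: "u \<noteq> u0"
      using u u0 \<sigma> by auto
    have s: "slack i ?y = \<sigma> * (g - a $ u)"
      using flip[of "{u}"] u by simp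
    have au: "a $ u > 0"
      using u by (simp add: conflicts_def)
    \<comment> \<open>The slack vanishes or keeps its sign and shrinks, so the untouched coordinate
      \<open>u0\<close> still repairs the block.\<close>
    have "settled i ?y"
    proof (cases "g = a $ u")
      case True
      then show ?thesis using s by (simp add: settled_def)
    next
      case False
      have "?y $ u0 = y $ u0"
        using ne by (simp add: flip_nth)
      then show ?thesis
        using \<sigma>(1) s u u0 au False unfolding settled_def e_def
        by (elim disjE) (auto intro!: exI[of _ u0])
    qed
    then have "conflicts i (pump ?y) = conflicts i ?y"
      by (intro conflicts_cong pump_settled flip_binary y) auto
    also have "\<dots> = ?D - {u}"
      using conflicts_flip[OF y, of "{u, u}"] u by simp
    finally have "card (conflicts i (pump ?y)) < card ?D"
      using u by (metis card_Diff1_less finite)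
    then show ?thesis
      using that[OF u(1) u(1)] ne u0 by blast
  next
    case False
    then have large: "a $ v > g" if "v \<in> ?D" "e v = 1" for v
      using that by fastforce
    \<comment> \<open>With \<open>e v = 1\<close> at all conflicts, the sum \<open>g\<close> would
      be at least \<open>a $ u\<close>.\<close>
    obtain v where v: "v \<in> ?D" "e v = - 1"
    proof (rule ccontr)
      assume "\<not> thesis"
      then have "\<forall>v\<in>?D. e v = 1" using that e by blast
      then have "a $ u * e u \<le> g"
        unfolding g using u a_nonneg by (intro member_le_sum) auto
      then show False using large u by fastforce
    qed
    have uv: "u \<noteq> v" using u v by auto
    let ?y = "flip {u, v} y"
    have s: "slack i ?y = \<sigma> * (g - a $ u + a $ v)"
      using flip[of "{u, v}"] u v uv by simp
    have au: "a $ u > 0" "a $ v > 0" "blk u = i" "blk v = i" "g < a $ u"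
      using u v large by (auto simp: conflicts_def)
    have yu: "?y $ u = 1 - y $ u" "?y $ v = 1 - y $ v"
      by (simp_all add: flip_nth)
    let ?C = "{w. blk w = i \<and> pump ?y $ w \<noteq> ?y $ w}"
    have "card ?C \<le> 1"
    \<comment> \<open>One of the two flipped coordinates can move back to repair the block:
      \<open>v\<close> outweighs the remaining slack because \<open>g < a $ u\<close>, and
      \<open>u\<close> because \<open>g\<close> and \<open>a $ v\<close> are positive.\<close>
    proof (cases "g - a $ u + a $ v \<ge> 0")
      case True
      then show ?thesis
        using \<sigma>(1,3) s u(2) v(2) au yu(2) unfolding e_def
        by (intro pump_changes_at_most_one[of _ v] flip_binary y) (auto simp: abs_mult)
    next
      case False
      then show ?thesis
        using \<sigma>(1,3) s u(2) v(2) au yu(1) unfolding e_def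
        by (intro pump_changes_at_most_one[of _ u] flip_binary y) (auto simp: abs_mult)
    qed
    \<comment> \<open>The two flips remove two conflicts and \<open>pump\<close> adds at most
      one.\<close>
    moreover have "conflicts i (pump ?y) \<subseteq> conflicts i ?y \<union> ?C"
      by (auto simp: conflicts_def)
    then have "card (conflicts i (pump ?y)) \<le> card (conflicts i ?y) + card ?C"
      by (meson card_Un_le card_mono finite order_trans)
    moreover have "card (conflicts i ?y) + 2 = card ?D"
    proof -
      have "card (?D - {u, v}) = card ?D - 2"
        using u v uv by (subst card_Diff_subset) auto
      moreover have "card {u, v} \<le> card ?D"
        using u v by (intro card_mono) auto
      ultimately show ?thesis
        using conflicts_flip[OF y, of "{u, v}" i] u v uv by simp
    qed
    ultimately show ?thesis
      using that[OF u(1) v(1)] uv by linarith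
  qed
qed

section \<open>The potential of a block\<close>

text \<open>Subtracting 1 reflects that two conflicts can be resolved by one random step;
  \<open>max 1\<close> keeps the value positive on an infeasible block with a single
  conflict.\<close>

definition potential :: "'k \<Rightarrow> real ^ 'v \<Rightarrow> nat" where
  "potential i y = (if slack i y = 0 then 0 else max 1 (card (conflicts i y) - 1))"

lemma potential_eq_0_iff: "potential i y = 0 \<longleftrightarrow> slack i y = 0"
  by (simp add: potential_def)

lemma potential_cong: "(\<And>v. blk v = i \<Longrightarrow> x $ v = y $ v) \<Longrightarrow> potential i x = potential i y"
  using slack_cong[of i x y] conflicts_cong[of i x y] by (simp add: potential_def)

text \<open>The value 1 coming from \<open>max\<close> requires two coordinates in the block; an
  infeasible settled block has them by the last fact of \<open>descending_flip\<close>.\<close>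

lemma potential_le:
  assumes y: "y \<in> binary" and st: "settled i y"
  shows "potential i y \<le> block_size blk i - 1"
proof (cases "slack i y = 0")
  case False
  have sub: "conflicts i y \<subseteq> {v. blk v = i}"
    by (auto simp: conflicts_def)
  obtain u v where uv: "u \<in> conflicts i y" "v \<in> conflicts i y" "u \<noteq> v \<or> (\<exists>w. blk w = i \<and> w \<noteq> u)"
    using descending_flip[OF y st False] by metis
  then obtain w where w: "blk w = i" "w \<noteq> u"
    using sub by blast
  have "card {u, w} \<le> card {v. blk v = i}"
    using w uv sub by (intro card_mono) auto
  moreover have "card (conflicts i y) \<le> card {v. blk v = i}"
    using sub by (intro card_mono) auto
  ultimately show ?thesis
    using w by (auto simp: potential_def block_size_def)
qed (simp add: potential_def)

text \<open>With at most two conflicts, flipping all of them makes the block feasible and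
  \<open>pump\<close> keeps it so; with three or more, losing a conflict lowers the
  potential.\<close>

lemma potential_descent:
  assumes y: "y \<in> binary" and st: "settled i y" and nz: "slack i y \<noteq> 0"
  obtains u v where "blk u = i" "a $ u > 0" "blk v = i" "a $ v > 0"
    "potential i (pump (flip {u, v} y)) < potential i y"
proof -
  obtain u v where uv: "u \<in> conflicts i y" "v \<in> conflicts i y"
    "card (conflicts i (pump (flip {u, v} y))) < card (conflicts i y)"
    using descending_flip[OF y st nz] by metis
  show ?thesis
  proof (cases "card (conflicts i y) \<le> 2")
    case True
    have "card (conflicts i y) \<noteq> 0"
      using uv by auto
    then have "card (conflicts i y) = 1 \<or> card (conflicts i y) = 2"
      using True by linarith
    \<comment> \<open>\<open>p = q\<close> covers a single conflict.\<close>
    then obtain p q where pq: "conflicts i y = {p, q}"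
      by (metis card_1_singletonE card_2_iff insert_absorb2)
    have s: "slack i (flip {p, q} y) = 0"
      using slack_flip[of "{p, q}" i y] slack_conflicts[OF y, of i]
      by (auto simp: pq[symmetric] conflicts_def)
    then have "settled i (flip {p, q} y)"
      by (simp add: settled_def)
    then have "slack i (pump (flip {p, q} y)) = slack i (flip {p, q} y)"
      by (intro slack_cong pump_settled flip_binary y) auto
    then have "potential i (pump (flip {p, q} y)) < potential i y"
      using s nz by (simp add: potential_def)
    moreover have "p \<in> conflicts i y" "q \<in> conflicts i y"
      by (auto simp: pq)
    ultimately show ?thesis
      using that by (auto simp: conflicts_def)
  next
    case False
    then have "potential i (pump (flip {u, v} y)) < potential i y"
      using uv nz by (auto simp: potential_def)
    then show ?thesis
      using that uv by (auto simp: conflicts_def)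
  qed
qed

end

section \<open>Probabilities under sequential sampling\<close>

lemma prob_bind_pmf:
  "measure_pmf.prob (bind_pmf M f) A = (\<integral>s. measure_pmf.prob (f s) A \<partial>measure_pmf M)"
proof -
  have "ennreal (measure_pmf.prob (bind_pmf M f) A) = (\<integral>\<^sup>+s. ennreal (measure_pmf.prob (f s) A) \<partial>measure_pmf M)"
    by (simp flip: measure_pmf.emeasure_eq_measure)
  also have "\<dots> = ennreal (\<integral>s. measure_pmf.prob (f s) A \<partial>measure_pmf M)"
    by (intro nn_integral_eq_integral measure_pmf.integrable_const_bound[where B = 1]) auto
  finally show ?thesis
    by (simp add: integral_nonneg_AE)
qed

text \<open>Splitting along \<open>B\<close> gives \<open>q * x + (1 - q) * z\<close> with
  \<open>q\<close> the probability of \<open>B\<close>; as \<open>x \<le> z\<close>, this only grows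
  when \<open>q\<close> is lowered to \<open>p\<close>.\<close>

lemma prob_bind_pmf_le_mix:
  assumes p: "p \<le> measure_pmf.prob M B" and "x \<le> z"
    and B: "\<And>s. s \<in> set_pmf M \<Longrightarrow> s \<in> B \<Longrightarrow> measure_pmf.prob (f s) A \<le> x"
    and all: "\<And>s. s \<in> set_pmf M \<Longrightarrow> measure_pmf.prob (f s) A \<le> z"
  shows "measure_pmf.prob (bind_pmf M f) A \<le> p * x + (1 - p) * z"
proof -
  have int: "integrable (measure_pmf M) (indicator B :: _ \<Rightarrow> real)"
    by (intro measure_pmf.integrable_const_bound[where B = 1]) auto
  have "measure_pmf.prob (bind_pmf M f) A \<le> (\<integral>s. z - (z - x) * indicator B s \<partial>measure_pmf M)"
    unfolding prob_bind_pmf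
  proof (rule integral_mono_AE)
    show "integrable (measure_pmf M) (\<lambda>s. measure_pmf.prob (f s) A)"
      by (intro measure_pmf.integrable_const_bound[where B = 1]) auto
    show "integrable (measure_pmf M) (\<lambda>s. z - (z - x) * indicator B s)"
      by (intro measure_pmf.integrable_const_bound[where B = "\<bar>z\<bar> + \<bar>x\<bar>"]) (auto simp: indicator_def)
    show "AE s in measure_pmf M. measure_pmf.prob (f s) A \<le> z - (z - x) * indicator B s"
      using B all by (auto simp: AE_measure_pmf_iff indicator_def)
  qed
  also have "\<dots> = z - (z - x) * measure_pmf.prob M B"
    using int by (subst Bochner_Integration.integral_diff) auto
  also have "\<dots> \<le> z - (z - x) * p"
    using assms(1,2) by (intro diff_left_mono mult_left_mono) auto
  finally show ?thesis
    by (simp add: algebra_simps)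
qed

lemma prob_bind_pmf_le:
  "(\<And>s. s \<in> set_pmf M \<Longrightarrow> measure_pmf.prob (f s) A \<le> z) \<Longrightarrow> measure_pmf.prob (bind_pmf M f) A \<le> z"
  using prob_bind_pmf_le_mix[of 0 M "{}" z z f A] by simp

text \<open>Only the outcome \<open>[u, v]\<close> is counted, which also covers
  \<open>u = v\<close>.\<close>

lemma prob_two_samples:
  assumes "finite S" "u \<in> S" "v \<in> S"
  shows "1 / (real (card S))\<^sup>2 \<le> measure_pmf.prob (replicate_pmf 2 (pmf_of_set S)) {js. set js = {u, v}}"
proof -
  have "replicate_pmf 2 (pmf_of_set S) = map_pmf (\<lambda>(x, y). [x, y]) (pair_pmf (pmf_of_set S) (pmf_of_set S))"
    by (simp add: numeral_2_eq_2 pair_pmf_def map_pmf_def bind_assoc_pmf bind_return_pmf)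
  then have "measure_pmf.prob (replicate_pmf 2 (pmf_of_set S)) {js. set js = {u, v}}
    = measure_pmf.prob (pair_pmf (pmf_of_set S) (pmf_of_set S)) {(x, y). {x, y} = {u, v}}"
    by (auto intro!: arg_cong2[of _ _ _ _ measure_pmf.prob])
  also have "\<dots> \<ge> measure_pmf.prob (pair_pmf (pmf_of_set S) (pmf_of_set S)) {(u, v)}"
    by (intro measure_pmf.finite_measure_mono) auto
  also have "measure_pmf.prob (pair_pmf (pmf_of_set S) (pmf_of_set S)) {(u, v)} = 1 / (real (card S))\<^sup>2"
  proof -
    have "S \<noteq> {}"
      using assms by blast
    then show ?thesis
      using assms by (simp add: measure_pmf_single pmf_pair power2_eq_square)
  qed
  finally show ?thesis .
qed

section \<open>A recursion for the failure probability\<close>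

text \<open>
  A bound on the probability that \<open>j\<close> random steps do not bring a potential, now \<open>m\<close>, to \<open>0\<close>, if each
  step decreases it with probability at least \<open>p\<close> and otherwise may raise it up to \<open>r\<close>.
\<close>

primrec fail_bound :: "real \<Rightarrow> nat \<Rightarrow> nat \<Rightarrow> nat \<Rightarrow> real" where
  "fail_bound p r 0 m = (if m = 0 then 0 else 1)"
| "fail_bound p r (Suc j) m =
     (if m = 0 then 0 else p * fail_bound p r j (m - 1) + (1 - p) * fail_bound p r j r)"

lemma fail_bound_0 [simp]: "fail_bound p r j 0 = 0"
  by (cases j) auto

context
  fixes p :: real and r :: nat
  assumes p: "0 \<le> p" "p \<le> 1"
begin

lemma fail_bound_nonneg: "0 \<le> fail_bound p r j m"
  using p by (induction j arbitrary: m) auto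

lemma fail_bound_le_1: "fail_bound p r j m \<le> 1"
proof (induction j arbitrary: m)
  case (Suc j)
  then have "p * fail_bound p r j (m - 1) + (1 - p) * fail_bound p r j r \<le> p * 1 + (1 - p) * 1"
    using p by (intro add_mono mult_left_mono) auto
  then show ?case by simp
qed simp

lemma fail_bound_mono: "m \<le> m' \<Longrightarrow> fail_bound p r j m \<le> fail_bound p r j m'"
proof (induction j arbitrary: m m')
  case (Suc j)
  show ?case
  proof (cases "m = 0")
    case True
    then show ?thesis using fail_bound_nonneg[of "Suc j" m'] by (simp del: fail_bound.simps)
  next
    case False
    then show ?thesis using Suc p by (auto intro!: add_mono mult_left_mono)
  qed
qed simp

lemma fail_bound_Suc_le: "fail_bound p r (Suc j) m \<le> fail_bound p r j m"
proof (induction j arbitrary: m)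
  case 0
  then show ?case using fail_bound_le_1[of "Suc 0" m] by (cases "m = 0") auto
next
  case (Suc j)
  show ?case
  proof (cases "m = 0")
    case False
    have "p * fail_bound p r (Suc j) (m - 1) + (1 - p) * fail_bound p r (Suc j) r
        \<le> p * fail_bound p r j (m - 1) + (1 - p) * fail_bound p r j r"
      using p by (intro add_mono mult_left_mono Suc) auto
    then show ?thesis
      using False by (simp del: fail_bound.simps(2) add: fail_bound.simps(2)[of p r "Suc j" m] fail_bound.simps(2)[of p r j m])
  qed simp
qed

text \<open>\<open>m\<close> successes in a row reach 0 within \<open>s\<close> steps and have
  probability \<open>p ^ m\<close>; after a first failure the potential is at most \<open>r\<close>
  and at least \<open>j\<close> steps remain.\<close>

lemma fail_bound_add_le:
  assumes "m \<le> s"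
  shows "fail_bound p r (s + j) m \<le> (1 - p ^ m) * fail_bound p r j r"
  using assms
proof (induction s arbitrary: m)
  case (Suc s)
  show ?case
  proof (cases m)
    case (Suc m')
    have anti: "fail_bound p r (s + j) r \<le> fail_bound p r j r"
    proof (induction s)
      case (Suc s)
      then show ?case using fail_bound_Suc_le[of "s + j" r] by (simp del: fail_bound.simps)
    qed simp
    have "fail_bound p r (Suc s + j) m = p * fail_bound p r (s + j) m' + (1 - p) * fail_bound p r (s + j) r"
      using Suc by simp
    also have "\<dots> \<le> p * ((1 - p ^ m') * fail_bound p r j r) + (1 - p) * fail_bound p r j r"
      using p anti Suc.IH[of m'] Suc.prems Suc by (intro add_mono mult_left_mono) auto
    also have "\<dots> = (1 - p ^ m) * fail_bound p r j r"
      using Suc by (simp add: algebra_simps)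
    finally show ?thesis .
  qed simp
qed simp

text \<open>The steps form \<open>N\<close> phases of length \<open>r\<close>; from any potential up
  to \<open>r\<close>, a phase reaches 0 with probability at least \<open>p ^ r\<close>.\<close>

lemma fail_bound_phases:
  assumes "m \<le> r"
  shows "fail_bound p r (r * N) m \<le> (1 - p ^ r) ^ N"
  using assms
proof (induction N arbitrary: m)
  case (Suc N)
  have "fail_bound p r (r * Suc N) m \<le> fail_bound p r (r + r * N) r"
    using Suc.prems fail_bound_mono by simp
  also have "\<dots> \<le> (1 - p ^ r) * fail_bound p r (r * N) r"
    by (rule fail_bound_add_le) simp
  also have "\<dots> \<le> (1 - p ^ r) * (1 - p ^ r) ^ N"
    using p Suc.IH[of r] by (intro mult_left_mono) (auto simp: power_le_one)
  finally show ?case by simp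
qed (simp)

end

section \<open>Certificates and runs of the algorithm\<close>

locale wfp_run = subset_sum blk a b proj xs
  for blk :: "'v::finite \<Rightarrow> 'k::finite" and a b proj xs +
  fixes cert :: "(real ^ 'v) list \<Rightarrow> (real ^ ('k + 'k)) pmf"
  assumes cert: "is_certificate_rule (ineq_matrix blk a) (ineq_rhs b) P cert"
    and block_nonempty: "\<And>i. block_size blk i \<ge> 1"
begin

abbreviation A where "A \<equiv> ineq_matrix blk a"
abbreviation \<beta> where "\<beta> \<equiv> ineq_rhs b"

lemma row_violation:
  "(A *v y) $ r - \<beta> $ r = (case r of Inl i \<Rightarrow> slack i y | Inr i \<Rightarrow> - slack i y)"
  by (cases r)
     (simp_all add: ineq_matrix_def ineq_rhs_def matrix_vector_mult_def slack_def sum_negf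
       if_distrib[of "\<lambda>t. t * _"] sum.If_cases cong: if_cong)

text \<open>A certificate gives positive weight to some violated row. That row alone is a
  certificate, so by minimality it is the whole support.\<close>

lemma minimal_certificate_block:
  assumes "minimal_certificate A \<beta> y lam"
  obtains i where "slack i y \<noteq> 0" "supp (lam v* A) = {v. blk v = i \<and> a $ v > 0}"
proof -
  have nonneg: "\<And>r. 0 \<le> lam $ r" and viol: "\<not> (lam v* A) \<bullet> y \<le> lam \<bullet> \<beta>"
    and min: "\<And>mu. projected_certificate A \<beta> y mu \<Longrightarrow> \<not> supp mu \<subset> supp lam"
    using assms by (auto simp: minimal_certificate_def projected_certificate_def)
  have dot: "(mu v* A) \<bullet> y - mu \<bullet> \<beta> = (\<Sum>r\<in>UNIV. mu $ r * ((A *v y) $ r - \<beta> $ r))" for mu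
    unfolding dot_lmul_matrix by (simp add: inner_vec_def right_diff_distrib sum_subtractf)
  have "\<exists>r. lam $ r * ((A *v y) $ r - \<beta> $ r) > 0"
  proof (rule ccontr)
    assume "\<not> ?thesis"
    then have "(\<Sum>r\<in>UNIV. lam $ r * ((A *v y) $ r - \<beta> $ r)) \<le> 0"
      by (intro sum_nonpos) (auto simp: not_less)
    then show False using viol dot[of lam] by simp
  qed
  then obtain r where r: "lam $ r * ((A *v y) $ r - \<beta> $ r) > 0" ..
  then have lr: "lam $ r > 0" and vr: "(A *v y) $ r - \<beta> $ r > 0"
    using nonneg[of r] by (auto simp: zero_less_mult_iff)
  have "(\<Sum>r'\<in>UNIV. axis r 1 $ r' * ((A *v y) $ r' - \<beta> $ r'))
      = (\<Sum>r'\<in>UNIV. if r' = r then (A *v y) $ r - \<beta> $ r else 0)"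
    by (intro sum.cong) (auto simp: axis_def)
  also have "\<dots> = (A *v y) $ r - \<beta> $ r"
    by simp
  finally have "0 < (axis r 1 v* A) \<bullet> y - axis r 1 \<bullet> \<beta>"
    unfolding dot using vr by (simp only:)
  then have "\<not> (axis r 1 v* A) \<bullet> y \<le> axis r 1 \<bullet> \<beta>"
    by linarith
  moreover have "0 \<le> (axis r 1 :: real ^ ('k + 'k)) $ r'" for r'
    by (simp add: axis_def)
  ultimately have "projected_certificate A \<beta> y (axis r 1)"
    unfolding projected_certificate_def by blast
  then have "\<not> supp (axis r 1 :: real ^ ('k + 'k)) \<subset> supp lam"
    by (rule min)
  moreover have "supp (axis r 1 :: real ^ ('k + 'k)) = {r}"
    by (simp add: supp_def axis_def)
  moreover have "r \<in> supp lam"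
    using lr by (simp add: supp_def)
  ultimately have "supp lam = {r}"
    by (metis empty_subsetI insert_subset psubsetI)
  then have zero: "lam $ r' = 0" if "r' \<noteq> r" for r'
    using that unfolding supp_def by (metis (mono_tags, lifting) mem_Collect_eq singletonD)
  have row: "(lam v* A) $ v = lam $ r * A $ r $ v" for v
  proof -
    have "(lam v* A) $ v = (\<Sum>r'\<in>UNIV. if r' = r then lam $ r * A $ r $ v else 0)"
      unfolding vector_matrix_mult_def vec_lambda_beta
    proof (rule sum.cong)
      show "lam $ r' * A $ r' $ v = (if r' = r then lam $ r * A $ r $ v else 0)"
        if "r' \<in> UNIV" for r'
        using zero[of r'] by (cases "r' = r") simp_all
    qed (rule refl)
    then show ?thesis by (simp only: sum.delta finite UNIV_I if_True)
  qed
  define i where "i = (case r of Inl i \<Rightarrow> i | Inr i \<Rightarrow> i)"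
  have "slack i y \<noteq> 0"
    using vr unfolding row_violation i_def by (auto split: sum.splits)
  moreover have "supp (lam v* A) = {v. blk v = i \<and> a $ v > 0}"
  proof -
    have "A $ r $ v \<noteq> 0 \<longleftrightarrow> blk v = i \<and> a $ v > 0" for v
      using a_nonneg[of v] by (cases r) (auto simp: i_def ineq_matrix_def)
    then show ?thesis
      using lr unfolding supp_def row by simp
  qed
  ultimately show ?thesis using that by blast
qed

text \<open>Splits off the first iteration, while \<open>wfp\<close> splits off the last; the
  induction on the remaining iterations needs arbitrary starting states.\<close>

primrec wfp_from :: "nat \<Rightarrow> (real ^ 'v) run \<Rightarrow> (real ^ 'v) run pmf" where
  "wfp_from 0 s = return_pmf s"
| "wfp_from (Suc t) s = wfp_step A P proj cert 2 s \<bind> wfp_from t"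

lemma wfp_from_Suc2: "wfp_from (Suc t) s = wfp_from t s \<bind> wfp_step A P proj cert 2"
proof (induction t arbitrary: s)
  case 0
  have "wfp_from 0 = return_pmf"
    by (intro ext) simp
  then show ?case
    by (simp add: bind_return_pmf bind_return_pmf')
next
  case (Suc t)
  have "wfp_from (Suc t) = (\<lambda>s. wfp_from t s \<bind> wfp_step A P proj cert 2)"
    using Suc by (intro ext)
  then have "wfp_from (Suc (Suc t)) s = wfp_step A P proj cert 2 s \<bind> (\<lambda>s. wfp_from t s \<bind> wfp_step A P proj cert 2)"
    by (simp only: wfp_from.simps(2)[of "Suc t"])
  then show ?case
    unfolding wfp_from.simps(2)[of t s] by (simp only: bind_assoc_pmf)
qed

lemma wfp_eq_wfp_from: "wfp A P proj cert 2 x0 t = wfp_from t (Running [round01 x0])"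
  by (induction t) (simp_all only: wfp.simps wfp_from.simps(1) wfp_from_Suc2)

definition fail :: "nat \<Rightarrow> (real ^ 'v) run \<Rightarrow> real" where
  "fail t s = measure_pmf.prob (wfp_from t s) (- {Returned x |x. x \<in> P \<inter> binary})"

lemma wfp_from_Returned: "wfp_from t (Returned x) = return_pmf (Returned x)"
  by (induction t) (simp_all add: bind_return_pmf)

lemma fail_pump_feasible: "pump y \<in> P \<Longrightarrow> fail (Suc t) (Running (y # h)) = 0"
  using pump_binary[of y]
  by (simp add: fail_def pump_def[symmetric] bind_return_pmf wfp_from_Returned)

lemma fail_pump_moves:
  "pump y \<notin> P \<Longrightarrow> pump y \<noteq> y \<Longrightarrow> fail (Suc t) (Running (y # h)) = fail t (Running (pump y # y # h))"
  by (simp add: fail_def pump_def[symmetric] bind_return_pmf)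

lemma fail_stalled:
  "pump y \<notin> P \<Longrightarrow> pump y = y \<Longrightarrow> fail (Suc t) (Running (y # h)) =
    measure_pmf.prob (cert (y # h) \<bind> (\<lambda>lam. replicate_pmf 2 (pmf_of_set (supp (lam v* A))) \<bind>
      (\<lambda>js. wfp_from t (Running (flip (set js) y # y # h))))) (- {Returned x |x. x \<in> P \<inter> binary})"
  by (simp add: fail_def pump_def[symmetric] rand_walk_sat_def map_pmf_def bind_assoc_pmf bind_return_pmf)

definition descent_prob :: "'k \<Rightarrow> real" where
  "descent_prob i = 1 / (real (block_size blk i))\<^sup>2"

text \<open>\<open>j\<close> is the budget of random steps on block \<open>i\<close>; a failed step
  leaves a potential of at most \<open>block_size blk i - 1\<close>.\<close>

definition block_bound :: "'k \<Rightarrow> nat \<Rightarrow> real ^ 'v \<Rightarrow> real" where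
  "block_bound i j y = fail_bound (descent_prob i) (block_size blk i - 1) j (potential i y)"

lemma descent_prob: "0 \<le> descent_prob i" "descent_prob i \<le> 1"
  using block_nonempty[of i] by (auto simp: descent_prob_def divide_le_eq)

lemma block_bound_nonneg: "0 \<le> block_bound i j y"
  unfolding block_bound_def using descent_prob by (intro fail_bound_nonneg)

lemma block_bound_cong: "(\<And>v. blk v = i \<Longrightarrow> x $ v = y $ v) \<Longrightarrow> block_bound i j x = block_bound i j y"
  using potential_cong[of i x y] by (simp add: block_bound_def)

text \<open>A point that is not settled costs one additional iteration, which makes it settled.\<close>

lemma fail_le_settled:
  assumes IH: "\<And>t' h y. t' \<in> {t, Suc t} \<Longrightarrow> y \<in> binary \<Longrightarrow> (\<And>i. settled i y) \<Longrightarrow>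
      fail t' (Running (y # h)) \<le> (\<Sum>i\<in>UNIV. block_bound i (K i) y)"
    and y: "y \<in> binary"
  shows "fail (Suc t) (Running (y # h)) \<le> (\<Sum>i\<in>UNIV. block_bound i (K i) (pump y))"
proof -
  consider "pump y \<in> P" | "pump y = y" | "pump y \<notin> P" "pump y \<noteq> y"
    by blast
  then show ?thesis
  proof cases
    case 1
    then show ?thesis
      by (simp add: fail_pump_feasible sum_nonneg block_bound_nonneg)
  next
    case 2
    then show ?thesis
      using IH[of "Suc t" y h] y settled_pump[OF y] by simp
  next
    case 3
    then show ?thesis
      using IH[of t "pump y" "y # h"] settled_pump[OF y] pump_binary by (simp add: fail_pump_moves)
  qed
qed

text \<open>Every random step is charged two iterations, its own and one for \<open>pump\<close> to
  settle the result; the extra 1 pays for the iteration that returns.\<close>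

lemma fail_le_block_bounds:
  assumes "y \<in> binary" "\<And>i. settled i y" "2 * (\<Sum>i\<in>UNIV. K i) + 1 \<le> t"
  shows "fail t (Running (y # h)) \<le> (\<Sum>i\<in>UNIV. block_bound i (K i) y)"
  using assms
proof (induction t arbitrary: y h K rule: less_induct)
  case (less t)
  note y = less.prems(1,2)
  have fixed: "pump y = y"
    using y by (rule pump_fixed)
  obtain t1 where t1: "t = Suc t1"
    using less.prems(3) by (cases t) auto
  \<comment> \<open>An infeasible block without budget has bound 1, which makes the claim trivial;
    otherwise the block selected by the certificate has a step left.\<close>
  consider "y \<in> P" | i where "slack i y \<noteq> 0" "K i = 0" | "y \<notin> P" "\<And>i. slack i y \<noteq> 0 \<Longrightarrow> K i > 0"
    by blast
  then show ?case
  proof cases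
    case 1
    then show ?thesis
      using fixed t1 by (simp add: fail_pump_feasible sum_nonneg block_bound_nonneg)
  next
    case (2 i)
    have "fail t (Running (y # h)) \<le> 1"
      by (simp add: fail_def)
    also have "\<dots> = block_bound i (K i) y"
      using 2 by (simp add: block_bound_def potential_eq_0_iff)
    also have "\<dots> \<le> (\<Sum>i\<in>UNIV. block_bound i (K i) y)"
      by (intro member_le_sum block_bound_nonneg) auto
    finally show ?thesis .
  next
    case 3
    have "pump y \<notin> P"
      using 3(1) fixed by simp
    show ?thesis
      unfolding t1 fail_stalled[OF \<open>pump y \<notin> P\<close> fixed]
    proof (rule prob_bind_pmf_le)
      fix lam assume "lam \<in> set_pmf (cert (y # h))"
      then have "minimal_certificate A \<beta> y lam"
        using cert y(1) 3(1) by (auto simp: is_certificate_rule_def)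
      then obtain i where i: "slack i y \<noteq> 0" and S: "supp (lam v* A) = {v. blk v = i \<and> a $ v > 0}"
        by (rule minimal_certificate_block)
      let ?S = "{v. blk v = i \<and> a $ v > 0}"
      obtain u v where "blk u = i" "a $ u > 0" "blk v = i" "a $ v > 0"
        and descent: "potential i (pump (flip {u, v} y)) < potential i y"
        by (rule potential_descent[OF y(1) y(2) i])
      then have uv: "u \<in> ?S" "v \<in> ?S"
        by auto
      obtain j where j: "K i = Suc j"
        using 3(2)[OF i] by (cases "K i") auto
      define K' where "K' = K(i := j)"
      have KK': "(\<Sum>i\<in>UNIV. K i) = Suc (\<Sum>i\<in>UNIV. K' i)"
        by (simp add: K'_def j sum.remove[of UNIV i])
      \<comment> \<open>One iteration is spent on the random step and one is reserved for settling
        the flipped point.\<close>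
      then obtain t2 where t2: "t1 = Suc t2" "2 * (\<Sum>i\<in>UNIV. K' i) + 1 \<le> t2"
        using less.prems(3) t1 by (cases t1) auto
      define R where "R = (\<Sum>l\<in>UNIV - {i}. block_bound l (K l) y)"
      let ?F = "fail_bound (descent_prob i) (block_size blk i - 1) j"
      have step: "fail t1 (Running (flip J y # y # h)) \<le> ?F (potential i (pump (flip J y))) + R"
        if J: "J \<subseteq> ?S" for J
      proof -
        have "fail t1 (Running (flip J y # y # h)) \<le> (\<Sum>l\<in>UNIV. block_bound l (K' l) (pump (flip J y)))"
          unfolding t2(1)
        proof (rule fail_le_settled)
          show "flip J y \<in> binary" using y(1) by (rule flip_binary)
        qed (use less.IH t2 t1 in auto)
        also have "\<dots> = ?F (potential i (pump (flip J y)))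
            + (\<Sum>l\<in>UNIV - {i}. block_bound l (K' l) (pump (flip J y)))"
          by (simp add: sum.remove[of UNIV i] K'_def block_bound_def)
        \<comment> \<open>The flip does not touch the other blocks, and \<open>pump\<close> fixes
          them since they are settled.\<close>
        also have "(\<Sum>l\<in>UNIV - {i}. block_bound l (K' l) (pump (flip J y))) = R"
          unfolding R_def
        proof (intro sum.cong refl)
          fix l assume l: "l \<in> UNIV - {i}"
          have flip: "flip J y $ w = y $ w" if "blk w = l" for w
            using that l J by (auto simp: flip_nth)
          then have "settled l (flip J y)"
            using y(2) settled_cong[of l "flip J y" y] by simp
          then have "pump (flip J y) $ w = y $ w" if "blk w = l" for w
            using that flip y(1) by (simp add: pump_settled flip_binary)
          then have "block_bound l (K l) (pump (flip J y)) = block_bound l (K l) y"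
            by (rule block_bound_cong)
          then show "block_bound l (K' l) (pump (flip J y)) = block_bound l (K l) y"
            using l by (simp add: K'_def)
        qed
        finally show ?thesis .
      qed
      \<comment> \<open>The support may be smaller than the block, which only makes the pair more
        likely.\<close>
      have p: "descent_prob i \<le> measure_pmf.prob (replicate_pmf 2 (pmf_of_set ?S)) {js. set js = {u, v}}"
      proof -
        define c where "c = card ?S"
        have "c \<le> block_size blk i"
          unfolding block_size_def c_def by (intro card_mono) auto
        moreover have "c > 0"
          using uv by (auto simp: card_gt_0_iff c_def)
        ultimately have "descent_prob i \<le> 1 / (real c)\<^sup>2"
          unfolding descent_prob_def by (intro divide_left_mono power_mono mult_pos_pos) auto
        also have "\<dots> \<le> measure_pmf.prob (replicate_pmf 2 (pmf_of_set ?S)) {js. set js = {u, v}}"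
          unfolding c_def using uv by (intro prob_two_samples) auto
        finally show ?thesis .
      qed
      \<comment> \<open>Success means drawing \<open>{u, v}\<close>; after any other draw
        \<open>pump\<close> still yields a settled block, whose potential is at most
        \<open>block_size blk i - 1\<close>.\<close>
      have "measure_pmf.prob (replicate_pmf 2 (pmf_of_set (supp (lam v* A))) \<bind>
          (\<lambda>js. wfp_from t1 (Running (flip (set js) y # y # h)))) (- {Returned x |x. x \<in> P \<inter> binary})
        \<le> descent_prob i * (?F (potential i y - 1) + R)
          + (1 - descent_prob i) * (?F (block_size blk i - 1) + R)"
        unfolding S
      proof (rule prob_bind_pmf_le_mix[OF p], goal_cases)
        case 1
        then show ?case
          using descent_prob potential_le[OF y(1) y(2), of i] by (intro add_right_mono fail_bound_mono) auto
      next
        case (2 js)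
        then have "fail t1 (Running (flip {u, v} y # y # h)) \<le> ?F (potential i (pump (flip {u, v} y))) + R"
          using uv by (intro step) auto
        also have "\<dots> \<le> ?F (potential i y - 1) + R"
          using descent_prob descent by (intro add_right_mono fail_bound_mono) auto
        finally show ?case
          using 2 by (simp add: fail_def)
      next
        case (3 js)
        have "set_pmf (pmf_of_set ?S) = ?S"
          using uv by (intro set_pmf_of_set) auto
        then have "set js \<subseteq> ?S"
          using 3 by (auto simp: set_replicate_pmf)
        then have "fail t1 (Running (flip (set js) y # y # h)) \<le> ?F (potential i (pump (flip (set js) y))) + R"
          by (rule step)
        also have "\<dots> \<le> ?F (block_size blk i - 1) + R"
          using descent_prob y(1) settled_pump pump_binary
          by (intro add_right_mono fail_bound_mono potential_le settled_pump flip_binary) auto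
        finally show ?case
          by (simp add: fail_def)
      qed
      also have "\<dots> = block_bound i (K i) y + R"
        using i by (simp add: block_bound_def j potential_eq_0_iff algebra_simps)
      also have "\<dots> = (\<Sum>i\<in>UNIV. block_bound i (K i) y)"
        by (simp add: R_def sum.remove[of UNIV i])
      finally show "measure_pmf.prob (replicate_pmf 2 (pmf_of_set (supp (lam v* A))) \<bind>
          (\<lambda>js. wfp_from t1 (Running (flip (set js) y # y # h)))) (- {Returned x |x. x \<in> P \<inter> binary})
        \<le> (\<Sum>i\<in>UNIV. block_bound i (K i) y)" .
    qed
  qed
qed


section \<open>Counting iterations\<close>

text \<open>The budget consists of \<open>block_size blk i ^ (2 * m) * L\<close> phases of
  \<open>m\<close> steps. A phase succeeds with probability at least \<open>q\<close>, the inverse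
  of \<open>block_size blk i ^ (2 * m)\<close>, and \<open>1 - q \<le> exp (- q)\<close>.\<close>

lemma block_bound_le_exp:
  assumes "y \<in> binary" "settled i y"
  defines "m \<equiv> block_size blk i - 1"
  shows "block_bound i (m * (block_size blk i ^ (2 * m) * L)) y \<le> exp (- real L)"
proof -
  define q where "q = descent_prob i ^ m"
  have q: "0 \<le> q" "q \<le> 1"
    using descent_prob[of i] by (auto simp: q_def power_le_one)
  have qN: "q * real (block_size blk i ^ (2 * m) * L) = real L"
    using block_nonempty[of i] by (simp add: q_def descent_prob_def power_one_over power_mult)
  have "block_bound i (m * (block_size blk i ^ (2 * m) * L)) y \<le> (1 - q) ^ (block_size blk i ^ (2 * m) * L)"
    unfolding block_bound_def q_def m_def
    using descent_prob potential_le[OF assms(1,2)] by (intro fail_bound_phases)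
  also have "\<dots> \<le> exp (- q) ^ (block_size blk i ^ (2 * m) * L)"
    using q exp_ge_add_one_self[of "- q"] by (intro power_mono) auto
  also have "\<dots> = exp (- (q * real (block_size blk i ^ (2 * m) * L)))"
    by (simp add: exp_of_nat_mult[symmetric] mult.commute del: of_nat_mult of_nat_power)
  finally show ?thesis
    unfolding qN .
qed

text \<open>Each random step costs two iterations. Blocks of size at least 2 leave room for
  \<open>2 * L\<close> more, since the target has a factor \<open>n ^ 3 \<ge> 2 * n\<close> beyond
  \<open>n ^ (2 * (n - 1))\<close>.\<close>

lemma block_budget:
  fixes n L :: nat
  assumes "n \<ge> 1"
  shows "2 * ((n - 1) * (n ^ (2 * (n - 1)) * L)) + (if n = 1 then 0 else 2 * L) \<le> L * n ^ (2 * n + 1)"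
proof (cases "n = 1")
  case False
  define x where "x = n ^ (2 * (n - 1))"
  have x: "x \<ge> 1"
    using assms by (simp add: x_def)
  have "2 * n + 1 = 2 * (n - 1) + 3"
    using assms by simp
  then have pow: "n ^ (2 * n + 1) = x * n ^ 3"
    by (simp only: x_def power_add)
  have "2 * 1 * n \<le> n * n * n"
    using False assms by (intro mult_le_mono) auto
  then have "2 * n \<le> n ^ 3"
    by (simp add: power3_eq_cube)
  have "2 * ((n - 1) * (x * L)) + 2 * L \<le> 2 * ((n - 1) * (x * L)) + 2 * (x * L)"
    using x by simp
  also have "\<dots> = 2 * n * (x * L)"
    using assms by (cases n) (auto simp: algebra_simps)
  also have "\<dots> \<le> n ^ 3 * (x * L)"
    using \<open>2 * n \<le> n ^ 3\<close> by (rule mult_right_mono) simp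
  finally show ?thesis
    unfolding pow x_def[symmetric] using False by (simp add: mult.commute mult.left_commute)
qed simp

lemma fail_le_exp:
  assumes y: "y \<in> binary" and L: "L \<ge> 1"
  shows "fail (L * (\<Sum>i\<in>UNIV. block_size blk i ^ (2 * block_size blk i + 1))) (Running [y])
    \<le> real CARD('k) * exp (- real L)"
proof -
  let ?n = "block_size blk"
  define T where "T = L * (\<Sum>i\<in>UNIV. ?n i ^ (2 * ?n i + 1))"
  define K where "K i = (?n i - 1) * (?n i ^ (2 * (?n i - 1)) * L)" for i
  have "T > 0"
    using L block_nonempty by (auto simp: T_def Suc_le_eq intro!: sum_pos)
  then obtain t where t: "T = Suc t"
    by (cases T) auto
  have "fail T (Running [y]) \<le> (\<Sum>i\<in>(UNIV :: 'k set). exp (- real L))"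
  proof (cases "\<forall>i. ?n i = 1")
    case True
    \<comment> \<open>A settled block of size 1 has potential 0, so the first iteration already
      returns.\<close>
    have "slack i (pump y) = 0" for i
      using potential_le[OF pump_binary settled_pump[OF y], of i] True potential_eq_0_iff by simp
    then have "pump y \<in> P"
      using pump_binary by (simp add: binary_mem_P_iff)
    then show ?thesis
      by (simp add: t fail_pump_feasible)
  next
    case False
    then obtain i0 where i0: "?n i0 \<noteq> 1"
      by blast
    \<comment> \<open>A block of size at least 2 supplies two spare iterations: one for settling the
      start, one for returning.\<close>
    have "2 * (\<Sum>i\<in>UNIV. K i) + 2 \<le> 2 * (\<Sum>i\<in>UNIV. K i) + (\<Sum>i\<in>{i0}. if ?n i = 1 then 0 else 2 * L)"
      using i0 L by simp
    also have "\<dots> \<le> 2 * (\<Sum>i\<in>UNIV. K i) + (\<Sum>i\<in>UNIV. if ?n i = 1 then 0 else 2 * L)"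
      by (intro add_left_mono sum_mono2) auto
    also have "\<dots> = (\<Sum>i\<in>UNIV. 2 * K i + (if ?n i = 1 then 0 else 2 * L))"
      by (simp add: sum.distrib sum_distrib_left)
    also have "\<dots> \<le> T"
      unfolding T_def K_def sum_distrib_left using block_nonempty by (intro sum_mono block_budget)
    finally have "2 * (\<Sum>i\<in>UNIV. K i) + 1 \<le> t"
      using t by simp
    then have "fail T (Running [y]) \<le> (\<Sum>i\<in>UNIV. block_bound i (K i) (pump y))"
      unfolding t using y by (intro fail_le_settled fail_le_block_bounds) auto
    also have "\<dots> \<le> (\<Sum>i\<in>(UNIV :: 'k set). exp (- real L))"
      unfolding K_def using y by (intro sum_mono block_bound_le_exp pump_binary settled_pump)
    finally show ?thesis .
  qed
  then show ?thesis
    by (simp add: T_def)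
qed

end

theorem theorem2p4:
  fixes blk :: "'v::finite \<Rightarrow> 'k::finite"
    and a :: "real ^ 'v" and b :: "real ^ 'k" and c :: "real ^ 'v" and x0 :: "real ^ 'v"
    and proj :: "real ^ 'v \<Rightarrow> real ^ 'v"
    and cert :: "(real ^ 'v) list \<Rightarrow> (real ^ ('k + 'k)) pmf"
    and \<delta> :: real
  defines "P \<equiv> lp_relax blk a b"
    and "A \<equiv> ineq_matrix blk a"
    and "\<beta> \<equiv> ineq_rhs b"
    and "n \<equiv> block_size blk"
    and "nbar \<equiv> Max (range (block_size blk))"
    and "k \<equiv> CARD('k)"
  defines "T \<equiv> real_of_int \<lceil>ln (real k / \<delta>)\<rceil> *
                 (\<Sum>i\<in>UNIV. real (n i) * 2 powr (2 * real (n i) * log 2 (real (n i))))"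
  assumes "\<And>i. n i \<ge> 1"
    and "\<And>v. a $ v \<ge> 0" and "\<And>i. b $ i \<ge> 0"
    and "P \<inter> binary \<noteq> {}"
    and "0 < \<delta>" and "\<delta> < 1"
    and "is_arg_min (\<lambda>x. c \<bullet> x) (\<lambda>x. x \<in> P) x0"
    and "is_l1_proj P proj"
    and "is_certificate_rule A \<beta> P cert"
  shows "measure_pmf.prob (wfp A P proj cert 2 x0 (nat \<lfloor>T\<rfloor>)) {Returned x |x. x \<in> P \<inter> binary} \<ge> 1 - \<delta>
    \<and> T \<le> real nbar * real k * 2 powr (2 * real nbar * log 2 (real nbar)) * real_of_int \<lceil>ln (real k / \<delta>)\<rceil>"
proof -
  define L where "L = nat \<lceil>ln (real k / \<delta>)\<rceil>"
  have n1: "n i \<ge> 1" for i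
    by fact
  have "real k \<ge> 1"
    by (simp add: k_def Suc_le_eq)
  then have ratio: "1 < real k / \<delta>"
    using \<open>0 < \<delta>\<close> \<open>\<delta> < 1\<close> by (simp add: less_divide_eq)
  then have "0 < \<lceil>ln (real k / \<delta>)\<rceil>"
    by simp
  then have L: "L \<ge> 1" "real_of_int \<lceil>ln (real k / \<delta>)\<rceil> = real L"
    unfolding L_def by linarith+
  have powr: "2 powr (2 * real m * log 2 (real m)) = real m ^ (2 * m)" if "m \<ge> 1" for m :: nat
  proof -
    have "2 powr (2 * real m * log 2 (real m)) = (2 powr log 2 (real m)) powr real (2 * m)"
      by (simp add: powr_powr mult.commute)
    also have "\<dots> = real m ^ (2 * m)"
      using that by (subst powr_realpow) auto
    finally show ?thesis .
  qed
  \<comment> \<open>\<open>T\<close> is a natural number, so the floor in the statement loses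
    nothing.\<close>
  have T: "T = real (L * (\<Sum>i\<in>UNIV. n i ^ (2 * n i + 1)))"
    unfolding T_def L(2) using n1 by (simp add: powr)
  obtain xs where xs: "xs \<in> P" "xs \<in> binary"
    using \<open>P \<inter> binary \<noteq> {}\<close> by blast
  interpret wfp_run blk a b proj xs cert
    using assms xs unfolding P_def A_def \<beta>_def n_def by unfold_locales auto
  let ?G = "{Returned x |x. x \<in> P \<inter> binary}"
  have "1 - measure_pmf.prob (wfp A P proj cert 2 x0 (nat \<lfloor>T\<rfloor>)) ?G
      = measure_pmf.prob (wfp A P proj cert 2 x0 (nat \<lfloor>T\<rfloor>)) (- ?G)"
    by (subst measure_pmf.prob_compl[symmetric]) (auto simp: Compl_eq_Diff_UNIV)
  also have "\<dots> = fail (L * (\<Sum>i\<in>UNIV. n i ^ (2 * n i + 1))) (Running [round01 x0])"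
    unfolding T floor_of_nat nat_int P_def A_def wfp_eq_wfp_from fail_def ..
  also have "\<dots> \<le> real k * exp (- real L)"
    unfolding n_def k_def using round01_binary L(1) by (rule fail_le_exp)
  \<comment> \<open>\<open>L\<close> is at least \<open>ln (real k / \<delta>)\<close>, so each of
    the \<open>k\<close> blocks contributes at most \<open>\<delta> / real k\<close>.\<close>
  also have "\<dots> \<le> real k * exp (- ln (real k / \<delta>))"
    unfolding L(2)[symmetric] by (intro mult_left_mono) auto
  also have "\<dots> = \<delta>"
    using ratio \<open>real k \<ge> 1\<close> \<open>0 < \<delta>\<close> by (simp add: exp_minus)
  finally have "measure_pmf.prob (wfp A P proj cert 2 x0 (nat \<lfloor>T\<rfloor>)) ?G \<ge> 1 - \<delta>"
    by simp
  moreover have "T \<le> real nbar * real k * 2 powr (2 * real nbar * log 2 (real nbar)) * real_of_int \<lceil>ln (real k / \<delta>)\<rceil>"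
  proof -
    have le: "n i \<le> nbar" for i
      unfolding n_def nbar_def by (intro Max_ge) auto
    then have nbar: "nbar \<ge> 1"
      using n1 order_trans by blast
    have "n i ^ (2 * n i + 1) \<le> nbar ^ (2 * nbar + 1)" for i
      using le[of i] nbar by (meson add_le_mono1 le0 mult_le_mono2 order_trans power_increasing power_mono)
    then have "(\<Sum>i\<in>UNIV. n i ^ (2 * n i + 1)) \<le> k * nbar ^ (2 * nbar + 1)"
      using sum_bounded_above[of UNIV "\<lambda>i. n i ^ (2 * n i + 1)" "nbar ^ (2 * nbar + 1)"] by (simp add: k_def)
    then have "T \<le> real (L * (k * nbar ^ (2 * nbar + 1)))"
      unfolding T of_nat_le_iff by (rule mult_left_mono) simp
    then show ?thesis
      unfolding L(2) powr[OF nbar] by (simp add: mult_ac)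
  qed
  ultimately show ?thesis ..
qed

end
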